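(* Let $f,g\in x+x^2\mathbb{C}[[x]]$ with $f\neq g$, and suppose that $p_s^f(\alpha)\,p_{1-s}^g(\alpha)=p_s^g(\alpha)\,p_{1-s}^f(\alpha)$ for all $s\in\mathbb{C}$. Then there exist $p,A,B\in\mathbb{C}$ such that $f(x)=\Delta_p(x)(1+A\Delta_{-p}(x))$ and $g(x)=\Delta_p(x)(1+B\Delta_{-p}(x))$.
   Context: $x+x^2\mathbb{C}[[x]]$ is the set of formal power series with zero constant term and linear coefficient 1. $\Delta_p(x)=(e^{px}-1)/p$ for $p\neq0$, $\Delta_0(x)=x$. For $f\in x+x^2\mathbb{C}[[x]]$ and $s\in\mathbb{C}$, write $(x/f(x))^s=\sum_{n\ge0}q_n(s)x^n/n!$ and define the formal series $p_s^f(\alpha)=\sum_{n\ge0}\binom{s-1}{n}q_n(s)\alpha^{s-n}\in\alpha^s+\alpha^{s-1}\mathbb{C}[[\alpha^{-1}]]$; products of such series are formed in the usual way (exponents adding). *)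

theory Defs
  imports Complex_Main "HOL-Computational_Algebra.Formal_Power_Series"
begin

unbundle fps_syntax

text \<open>The set \<open>x + x^2 \<complex>[[x]]\<close>.\<close>

definition delta_series :: "complex fps set" where
  "delta_series = {f. f $ 0 = 0 \<and> f $ 1 = 1}"

definition Delta :: "complex \<Rightarrow> complex fps" where
  "Delta p = (if p = 0 then fps_X else fps_const (1 / p) * (fps_exp p - 1))"

text \<open>The complex power \<open>h^s\<close> of a series \<open>h\<close> with constant term 1, as the binomial series
  \<open>(1 + y)^s\<close> evaluated at \<open>y = h - 1\<close>.\<close>

definition fps_cpow :: "complex fps \<Rightarrow> complex \<Rightarrow> complex fps" where
  "fps_cpow h s = fps_compose (fps_binomial s) (h - 1)"

text \<open>For \<open>f\<close> in \<^const>\<open>delta_series\<close>, \<open>fps_X / f\<close> has constant term 1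
  (division of formal power series cancels the common factor \<open>x\<close>).\<close>

definition q_coeff :: "complex fps \<Rightarrow> nat \<Rightarrow> complex \<Rightarrow> complex" where
  "q_coeff f n s = fact n * fps_cpow (fps_X / f) s $ n"

text \<open>A formal series in complex powers of \<open>\<alpha>\<close> is given by its coefficient function,
  mapping an exponent \<open>t\<close> to the coefficient of \<open>\<alpha>^t\<close>. The series
  \<open>\<alpha>^s (c 0 + c 1 \<alpha>^(-1) + c 2 \<alpha>^(-2) + \<dots>)\<close> is the following
  (the index set of the sum has at most one element):\<close>

type_synonym cseries = "complex \<Rightarrow> complex"

definition descending_series :: "complex \<Rightarrow> (nat \<Rightarrow> complex) \<Rightarrow> cseries" where
  "descending_series s c = (\<lambda>t. \<Sum>n | t = s - of_nat n. c n)"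

text \<open>The index set of the sum below is finite whenever both factors are descending series;
  see \<open>cseries_mult_descending\<close>.\<close>

definition cseries_mult :: "cseries \<Rightarrow> cseries \<Rightarrow> cseries" where
  "cseries_mult a b = (\<lambda>t. \<Sum>r | a r \<noteq> 0 \<and> b (t - r) \<noteq> 0. a r * b (t - r))"

definition p_series :: "complex fps \<Rightarrow> complex \<Rightarrow> cseries" where
  "p_series f s = descending_series s (\<lambda>n. ((s - 1) gchoose n) * q_coeff f n s)"

lemma descending_series_at [simp]:
  "descending_series s c (s - of_nat n) = c n"
proof -
  have "{m. s - of_nat n = s - (of_nat m :: complex)} = {n}" by auto
  then show ?thesis by (simp add: descending_series_def)
qed

lemma descending_series_nonzeroD:
  assumes "descending_series s c t \<noteq> 0"
  obtains n where "t = s - of_nat n"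
  using assms by (force simp: descending_series_def)

lemma cseries_mult_descending:
  "cseries_mult (descending_series s c) (descending_series r d) =
   descending_series (s + r) (\<lambda>n. \<Sum>k\<le>n. c k * d (n - k))"
proof
  fix t :: complex
  let ?a = "descending_series s c" and ?b = "descending_series r d"
  let ?S = "{u. ?a u \<noteq> 0 \<and> ?b (t - u) \<noteq> 0}"
  show "cseries_mult ?a ?b t = descending_series (s + r) (\<lambda>n. \<Sum>k\<le>n. c k * d (n - k)) t"
  proof (cases "\<exists>n. t = s + r - of_nat n")
    case True
    then obtain n where t: "t = s + r - of_nat n" by blast
    have split: "t - (s - of_nat k) = r - of_nat (n - k)" if "k \<le> n" for k
      using that by (simp add: t of_nat_diff)
    have sub: "?S \<subseteq> (\<lambda>k. s - of_nat k) ` {..n}"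
    proof
      fix u assume u: "u \<in> ?S"
      then obtain k m where k: "u = s - of_nat k" and m: "t - u = r - of_nat m"
        by (auto elim!: descending_series_nonzeroD)
      then have "(of_nat (k + m) :: complex) = of_nat n" using t unfolding of_nat_add by algebra
      then have "k + m = n" by (simp only: of_nat_eq_iff)
      then show "u \<in> (\<lambda>k. s - of_nat k) ` {..n}" using k by auto
    qed
    have "cseries_mult ?a ?b t = (\<Sum>u\<in>(\<lambda>k. s - of_nat k) ` {..n}. ?a u * ?b (t - u))"
      unfolding cseries_mult_def by (rule sum.mono_neutral_left) (use sub in auto)
    also have "\<dots> = (\<Sum>k\<le>n. ?a (s - of_nat k) * ?b (t - (s - of_nat k)))"
      by (subst sum.reindex) (auto simp: inj_on_def)
    also have "\<dots> = (\<Sum>k\<le>n. c k * d (n - k))"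
      by (rule sum.cong) (simp_all only: split descending_series_at atMost_iff)
    finally show ?thesis by (simp only: t descending_series_at)
  next
    case False
    have "?S = {}"
    proof (rule ccontr)
      assume "?S \<noteq> {}"
      then obtain u where "?a u \<noteq> 0" "?b (t - u) \<noteq> 0" by blast
      then obtain k m where "u = s - of_nat k" and "t - u = r - of_nat m"
        by (auto elim!: descending_series_nonzeroD)
      then have "t = s + r - of_nat (k + m)" unfolding of_nat_add by algebra
      with False show False by blast
    qed
    then have "cseries_mult ?a ?b t = 0" by (simp only: cseries_mult_def sum.empty)
    moreover have "descending_series (s + r) (\<lambda>n. \<Sum>k\<le>n. c k * d (n - k)) t = 0"
      using False by (simp add: descending_series_def)
    ultimately show ?thesis by simp
  qed
qed

end

theory Submission
  imports Defs
begin

text \<open>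
  For \<open>s = m + 1\<close> the series \<open>p\<^sub>s\<^sup>f\<close> has at most \<open>m + 1\<close> terms, while \<open>p\<^bsub>1-s\<^esub>\<^sup>g = p\<^bsub>-m\<^esub>\<^sup>g\<close> is up to
  signs the formal Laplace transform of \<open>g\<^sup>m\<close>. The hypothesis therefore becomes a differential
  equation, linear in \<open>f\<^sup>m\<close> and \<open>g\<^sup>m\<close>, and \<open>m = 1, 2\<close> suffice. Put \<open>a = f''(0)\<close>, \<open>b = g''(0)\<close>,
  \<open>c = f'''(0)\<close>. The case \<open>m = 1\<close> is \<open>g' + a g = f' + b f\<close>, so \<open>f \<noteq> g\<close> forces \<open>a \<noteq> b\<close>; writing
  \<open>f = S + (a/2) C\<close>, \<open>g = S + (b/2) C\<close> it says \<open>C' = 2 S\<close>. In these terms \<open>m = 2\<close> reads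
  \<open>E' + (a + b) E = 0\<close> for \<open>E = 4 S' C - 4 S\<^sup>2 - c C\<^sup>2\<close>, where \<open>E' = 4 (S'' - c S) C\<close>. As \<open>E(0) = 0\<close>, \<open>E = 0\<close>,
  so \<open>S'' = c S\<close>, and \<open>p\<close> is a square root of \<open>c\<close>.
\<close>

section \<open>Formal linear differential equations\<close>

lemma fact_times_fps_nth_deriv_nth:
  fixes f :: "'a::field_char_0 fps"
  shows "fact n * fps_nth_deriv j f $ n = fact (n + j) * f $ (n + j)"
proof (induction j arbitrary: f)
  case (Suc j)
  have "fact n * fps_nth_deriv (Suc j) f $ n = fact (n + j) * fps_deriv f $ (n + j)"
    by (simp add: Suc.IH)
  then show ?case by (simp add: algebra_simps)
qed simp

lemma fps_linear_ODE_unique_zero: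
  fixes E :: "'a::field_char_0 fps"
  assumes "fps_deriv E = fps_const e * E" and "E $ 0 = 0"
  shows "E = 0"
proof (rule fps_ext)
  fix n show "E $ n = 0 $ n"
  proof (induction n)
    case (Suc n)
    have "of_nat (Suc n) * E $ Suc n = fps_deriv E $ n" by simp
    also have "\<dots> = 0" using assms(1) Suc by simp
    finally show ?case by (simp del: of_nat_Suc)
  qed (use assms in simp)
qed

text \<open>For the difference \<open>d\<close>, the equation determines coefficient
  \<open>n + 3\<close> from coefficient \<open>n + 1\<close>, so three initial zeros propagate. This
  identifies \<open>f\<close> and \<open>g\<close> with the closed forms at the end.\<close>

lemma fps_third_order_ODE_unique:
  fixes f h :: "'a::field_char_0 fps"
  assumes "fps_deriv (fps_deriv (fps_deriv f)) = fps_const c * fps_deriv f"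
    and "fps_deriv (fps_deriv (fps_deriv h)) = fps_const c * fps_deriv h"
    and "f $ 0 = h $ 0" "f $ 1 = h $ 1" "f $ 2 = h $ 2"
  shows "f = h"
proof -
  define d where "d = f - h"
  have ode: "fps_deriv (fps_deriv (fps_deriv d)) = fps_const c * fps_deriv d"
    unfolding d_def by (simp add: assms(1,2) right_diff_distrib)
  have d012: "d $ 0 = 0" "d $ Suc 0 = 0" "d $ Suc (Suc 0) = 0"
    using assms(3-) by (simp_all add: d_def numeral_2_eq_2)
  have "d $ n = 0 \<and> d $ Suc n = 0 \<and> d $ Suc (Suc n) = 0" for n
  proof (induction n)
    case (Suc n)
    have "fps_deriv (fps_deriv (fps_deriv d)) $ n
        = of_nat (Suc n) * (of_nat (Suc (Suc n)) * (of_nat (Suc (Suc (Suc n))) * d $ Suc (Suc (Suc n))))"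
      by (simp del: of_nat_Suc)
    moreover have "(fps_const c * fps_deriv d) $ n = 0" using Suc by simp
    ultimately have "d $ Suc (Suc (Suc n)) = 0"
      by (metis ode mult_eq_0_iff of_nat_neq_0)
    with Suc show ?case by simp
  qed (use d012 in simp)
  then have "d = 0" by (simp add: fps_eq_iff)
  then show ?thesis by (simp add: d_def)
qed

section \<open>Complex powers at integer exponents\<close>

lemma fps_cpow_of_nat:
  assumes "h $ 0 = 1"
  shows "fps_cpow h (of_nat n) = h ^ n"
proof -
  have "fps_cpow h (of_nat n) = fps_compose (1 + fps_X) (h - 1) ^ n"
    unfolding fps_cpow_def fps_binomial_of_nat
    by (rule fps_compose_power[symmetric]) (simp add: assms)
  also have "fps_compose (1 + fps_X) (h - 1) = h"
    using assms by (simp add: fps_compose_add_distrib)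
  finally show ?thesis .
qed

lemma fps_cpow_minus_of_nat:
  assumes "h $ 0 = 1"
  shows "fps_cpow h (- of_nat n) = inverse h ^ n"
proof -
  have "(fps_binomial (- of_nat n) :: complex fps) * fps_binomial (of_nat n) = 1"
    by (simp flip: fps_binomial_add_mult)
  then have "fps_cpow h (- of_nat n) * fps_cpow h (of_nat n) = 1"
    unfolding fps_cpow_def using assms
    by (metis eq_iff_diff_eq_0 fps_compose_1 fps_compose_mult_distrib fps_one_nth fps_sub_nth)
  moreover have "inverse h ^ n * h ^ n = 1"
    using assms by (metis inverse_mult_eq_1 one_neq_zero power_mult_distrib power_one)
  moreover have "h ^ n \<noteq> 0"
    using assms by auto
  ultimately show ?thesis
    by (metis fps_cpow_of_nat[OF assms] mult_right_cancel)
qed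

section \<open>The hypothesis at \<open>s = m + 1\<close> as a differential equation\<close>

lemma delta_seriesE:
  assumes "f \<in> delta_series"
  obtains u where "f = fps_X * u" "u $ 0 = 1" "fps_X / f = inverse u"
proof
  let ?u = "fps_shift 1 f"
  show f: "f = fps_X * ?u"
    using assms by (auto simp: fps_eq_iff delta_series_def)
  show u0: "?u $ 0 = 1" using assms by (simp add: delta_series_def)
  have "?u * inverse ?u = 1"
    by (rule inverse_mult_eq_1') (use u0 in simp)
  then have "fps_X = inverse ?u * f"
    by (subst f) (simp add: algebra_simps)
  moreover have "f \<noteq> 0" using assms by (auto simp: delta_series_def)
  ultimately show "fps_X / f = inverse ?u"
    by (metis nonzero_mult_div_cancel_right)
qed

text \<open>Writing g = x u gives (x/g)^(-m) = u^m, whose coefficient n is coefficient n + m of g^m.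
  Upper negation of the binomial supplies the sign and the factorials.\<close>

lemma gchoose_q_coeff_minus:
  assumes "g \<in> delta_series"
  shows "((- of_nat m - 1) gchoose n) * q_coeff g n (- of_nat m)
       = (-1) ^ n * fact (n + m) / fact m * g ^ m $ (n + m)"
proof -
  obtain u where u: "g = fps_X * u" "u $ 0 = 1" "fps_X / g = inverse u"
    using assms by (rule delta_seriesE)
  have "fps_cpow (fps_X / g) (- of_nat m) = u ^ m"
    using u by (simp add: fps_cpow_minus_of_nat fps_inverse_idempotent)
  then have q: "q_coeff g n (- of_nat m) = fact n * g ^ m $ (n + m)"
    by (simp add: q_coeff_def u(1) power_mult_distrib fps_X_power_mult_nth)
  have "(- of_nat m - 1 :: complex) gchoose n = (-1) ^ n * (of_nat (n + m) gchoose n)"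
    using gbinomial_minus[of "of_nat m + 1 :: complex" n] by (simp add: add.commute minus_diff_commute)
  also have "\<dots> = (-1) ^ n * (fact (n + m) / (fact n * fact m))"
    unfolding binomial_gbinomial[symmetric] by (simp add: binomial_fact)
  finally show ?thesis by (simp add: q)
qed

text \<open>The exponents s and 1 - s add up to 1, so the index n of the product sits at exponent 1
  - n. Multiplying the second factor by \<alpha>^(m-k) acts on g^m as the derivative of order m - k,
  up to sign; no boundary terms arise because g^m starts at x^m.\<close>

lemma p_series_product_nth:
  assumes g: "g \<in> delta_series"
  shows "fact n * (\<Sum>k\<le>m. fps_const ((-1) ^ k * of_nat (m choose k) * q_coeff f k (of_nat (Suc m)))
             * fps_nth_deriv (m - k) (g ^ m)) $ n
       = (-1) ^ n * fact m *
         cseries_mult (p_series f (of_nat (Suc m))) (p_series g (1 - of_nat (Suc m))) (1 - of_nat n)"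
proof -
  define q where "q k = q_coeff f k (of_nat (Suc m))" for k
  define T where "T k = (-1) ^ k * of_nat (m choose k) * q k * (fact (n + m - k) * g ^ m $ (n + m - k))" for k
  have low: "\<forall>i<m. g ^ m $ i = 0"
    using g by (intro startsby_zero_power_prefix) (simp add: delta_series_def)
  have "fact n * (\<Sum>k\<le>m. fps_const ((-1) ^ k * of_nat (m choose k) * q k) * fps_nth_deriv (m - k) (g ^ m)) $ n
      = (\<Sum>k\<le>m. (-1) ^ k * of_nat (m choose k) * q k * (fact n * fps_nth_deriv (m - k) (g ^ m) $ n))"
    by (simp add: fps_sum_nth sum_distrib_left mult_ac)
  also have "\<dots> = (\<Sum>k\<le>m. T k)"
    by (rule sum.cong) (auto simp: T_def fact_times_fps_nth_deriv_nth)
  \<comment> \<open>The range changes from k \<le> m to k \<le> n. For n < k \<le> m the index n + m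
    - k lies below m, where g^m vanishes; for m < k \<le> n the binomial vanishes.\<close>
  also have "\<dots> = (\<Sum>k\<le>min m n. T k)"
    by (rule sum.mono_neutral_right) (use low in \<open>auto simp: T_def\<close>)
  also have "\<dots> = (\<Sum>k\<le>n. T k)"
    by (rule sum.mono_neutral_left) (auto simp: T_def)
  also have "\<dots> = (-1) ^ n * fact m * (\<Sum>k\<le>n. ((of_nat m gchoose k) * q k)
               * (((- of_nat m - 1) gchoose (n - k)) * q_coeff g (n - k) (- of_nat m)))"
    unfolding sum_distrib_left
  proof (rule sum.cong)
    fix k assume "k \<in> {..n}"
    then have k: "k \<le> n" "n + m - k = n - k + m" by auto
    have "(-1 :: complex) ^ n = (-1) ^ k * (-1) ^ (n - k)"
      using k(1) by (simp flip: power_add)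
    then have "(-1 :: complex) ^ n * (-1) ^ (n - k) = (-1) ^ k"
      by (simp flip: power_mult_distrib)
    then show "T k = (-1) ^ n * fact m * ((of_nat m gchoose k) * q k
               * (((- of_nat m - 1) gchoose (n - k)) * q_coeff g (n - k) (- of_nat m)))"
      unfolding gchoose_q_coeff_minus[OF g] T_def k(2)
      by (simp flip: binomial_gbinomial)
  qed simp
  also have "(\<Sum>k\<le>n. ((of_nat m gchoose k) * q k)
               * (((- of_nat m - 1) gchoose (n - k)) * q_coeff g (n - k) (- of_nat m)))
      = cseries_mult (p_series f (of_nat (Suc m))) (p_series g (1 - of_nat (Suc m))) (1 - of_nat n)"
    using descending_series_at[of 1 _ n]
    by (simp add: p_series_def cseries_mult_descending q_def)
  finally show ?thesis by (simp only: q_def)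
qed

lemma p_series_symmetric_ODE:
  assumes "f \<in> delta_series" and "g \<in> delta_series"
    and "cseries_mult (p_series f (of_nat (Suc m))) (p_series g (1 - of_nat (Suc m)))
       = cseries_mult (p_series g (of_nat (Suc m))) (p_series f (1 - of_nat (Suc m)))"
  shows "(\<Sum>k\<le>m. fps_const ((-1) ^ k * of_nat (m choose k) * q_coeff f k (of_nat (Suc m)))
             * fps_nth_deriv (m - k) (g ^ m))
       = (\<Sum>k\<le>m. fps_const ((-1) ^ k * of_nat (m choose k) * q_coeff g k (of_nat (Suc m)))
             * fps_nth_deriv (m - k) (f ^ m))" (is "?L = ?R")
proof (rule fps_ext)
  fix n
  have "fact n * ?L $ n = fact n * ?R $ n"
    unfolding p_series_product_nth[OF assms(1)] p_series_product_nth[OF assms(2)] assms(3) ..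
  then show "?L $ n = ?R $ n" by simp
qed

text \<open>These are the constants of the equations for orders 1 and 2, taken at exponents 2 and 3.
  The coefficients of v = x/f come from v u = 1, those of its powers by induction on the
  exponent.\<close>

lemma q_coeff_of_nat_low:
  assumes "f \<in> delta_series"
  shows "q_coeff f 0 (of_nat m) = 1"
    and "q_coeff f (Suc 0) (of_nat m) = - of_nat m * f $ 2"
    and "q_coeff f 2 (of_nat m) = of_nat m * (of_nat m + 1) * (f $ 2)\<^sup>2 - 2 * of_nat m * f $ 3"
proof -
  obtain u where u: "f = fps_X * u" "u $ 0 = 1" "fps_X / f = inverse u"
    using assms by (rule delta_seriesE)
  define v where "v = inverse u"
  have v0: "v $ 0 = 1" using u(2) by (simp add: v_def)
  have f2: "f $ 2 = u $ 1" and f3: "f $ 3 = u $ 2"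
    by (simp_all add: u(1))
  have vu: "v * u = 1" unfolding v_def by (rule inverse_mult_eq_1) (simp add: u)
  have v1: "v $ 1 = - f $ 2"
    using arg_cong[OF vu, of "\<lambda>h. h $ 1"] u(2) v0
    by (simp add: fps_mult_nth f2 add_eq_0_iff)
  have "u $ 2 + v $ 1 * u $ 1 + v $ 2 = 0"
    using arg_cong[OF vu, of "\<lambda>h. h $ 2"] u(2) v0
    by (simp add: fps_mult_nth numeral_2_eq_2 add.assoc)
  then have v2: "v $ 2 = (f $ 2)\<^sup>2 - f $ 3"
    unfolding v1 f2[symmetric] f3[symmetric] by (simp add: power2_eq_square algebra_simps)
  have w0: "(v ^ m) $ 0 = 1" for m using v0 by (induction m) auto
  have w1: "(v ^ m) $ Suc 0 = - of_nat m * f $ 2" for m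
  proof (induction m)
    case (Suc m)
    then show ?case using v0 v1 w0[of m] by (simp add: fps_mult_nth algebra_simps)
  qed simp
  have w2: "2 * (v ^ m) $ 2 = of_nat m * (of_nat m + 1) * (f $ 2)\<^sup>2 - 2 * of_nat m * f $ 3" for m
  proof (induction m)
    case (Suc m)
    have "2 * (v ^ Suc m) $ 2 = 2 * (v $ 0 * v ^ m $ 2 + v $ 1 * v ^ m $ 1 + v $ 2 * v ^ m $ 0)"
      by (simp add: fps_mult_nth numeral_2_eq_2)
    also have "\<dots> = 2 * v ^ m $ 2 + 2 * (of_nat m * (f $ 2)\<^sup>2) + 2 * ((f $ 2)\<^sup>2 - f $ 3)"
      using w1[of m] v1 by (simp add: v0 v2 w0 power2_eq_square)
    also have "\<dots> = of_nat (Suc m) * (of_nat (Suc m) + 1) * (f $ 2)\<^sup>2 - 2 * of_nat (Suc m) * f $ 3"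
      unfolding Suc by (simp add: algebra_simps power2_eq_square)
    finally show ?case .
  qed simp
  have q: "q_coeff f k (of_nat m) = fact k * (v ^ m) $ k" for k
    by (simp add: q_coeff_def u(3) fps_cpow_of_nat v0 flip: v_def)
  show "q_coeff f 0 (of_nat m) = 1" "q_coeff f (Suc 0) (of_nat m) = - of_nat m * f $ 2"
    "q_coeff f 2 (of_nat m) = of_nat m * (of_nat m + 1) * (f $ 2)\<^sup>2 - 2 * of_nat m * f $ 3"
    by (simp_all only: q w0 w1 w2 fact_0 fact_Suc_0 fact_2 mult_1)
qed

section \<open>The closed forms\<close>

lemma Delta_product_low:
  shows "(Delta p * (1 + fps_const A * Delta (- p))) $ 0 = 0"
    and "(Delta p * (1 + fps_const A * Delta (- p))) $ 1 = 1"
    and "(Delta p * (1 + fps_const A * Delta (- p))) $ 2 = A + p / 2"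
proof -
  have D: "Delta p $ 0 = 0" "Delta p $ Suc 0 = 1" "Delta p $ Suc (Suc 0) = p / 2" for p
    by (simp_all add: Delta_def)
  show "(Delta p * (1 + fps_const A * Delta (- p))) $ 0 = 0"
    "(Delta p * (1 + fps_const A * Delta (- p))) $ 1 = 1"
    "(Delta p * (1 + fps_const A * Delta (- p))) $ 2 = A + p / 2"
    by (simp_all add: fps_mult_nth numeral_2_eq_2 D)
qed

text \<open>For p = 0 the product is x + A x^2. Otherwise it is a linear combination of 1, e^(px)
  and e^(-px), because (e^(px) - 1)(e^(-px) - 1) = 2 - e^(px) - e^(-px).\<close>

lemma Delta_product_ODE:
  fixes p A :: complex
  defines "R \<equiv> Delta p * (1 + fps_const A * Delta (- p))"
  shows "fps_deriv (fps_deriv (fps_deriv R)) = fps_const (p\<^sup>2) * fps_deriv R"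
proof (cases "p = 0")
  case True
  then show ?thesis by (simp add: R_def Delta_def)
next
  case False
  define K where "K = fps_const (1 / p)"
  define L where "L = fps_const (A / p\<^sup>2)"
  have e: "fps_exp p * fps_exp (- p) = 1" by (simp flip: fps_exp_add_mult)
  have "L = - (K * fps_const A * fps_const (1 / (- p)))"
    using False by (simp add: K_def L_def power2_eq_square)
  moreover have "R = K * (fps_exp p - 1) * (1 + fps_const A * (fps_const (1 / (- p)) * (fps_exp (- p) - 1)))"
    using False by (simp add: R_def K_def Delta_def)
  ultimately have R: "R = K * (fps_exp p - 1) + L * (fps_exp p + fps_exp (- p) - 2)"
    using e by algebra
  have KL: "fps_deriv K = 0" "fps_deriv L = 0" by (simp_all add: K_def L_def)
  show ?thesis
    unfolding R by (simp add: KL algebra_simps power2_eq_square flip: fps_const_mult fps_const_neg)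
qed

section \<open>Solving the equations of orders 1 and 2\<close>

theorem theorem2p2:
  fixes f g :: "complex fps"
  assumes "f \<in> delta_series" and "g \<in> delta_series"
    and "f \<noteq> g"
    and "\<And>s :: complex. cseries_mult (p_series f s) (p_series g (1 - s)) =
                       cseries_mult (p_series g s) (p_series f (1 - s))"
  shows "\<exists>p A B :: complex.
           f = Delta p * (1 + fps_const A * Delta (- p)) \<and>
           g = Delta p * (1 + fps_const B * Delta (- p))"
proof -
  have f01: "f $ 0 = 0" "f $ Suc 0 = 1" and g01: "g $ 0 = 0" "g $ Suc 0 = 1"
    using assms(1,2) by (auto simp: delta_series_def)
  define a where "a = 2 * f $ 2"
  define b where "b = 2 * g $ 2"
  define c where "c = 6 * f $ 3"
  note qf = q_coeff_of_nat_low[OF assms(1)] and qg = q_coeff_of_nat_low[OF assms(2)]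
  note ODE = p_series_symmetric_ODE[OF assms(1,2) assms(4)]
  have one: "fps_deriv g + fps_const a * g = fps_deriv f + fps_const b * f"
    using ODE[of 1] qf[of 2] qg[of 2] by (simp add: a_def b_def)
  have ab: "a \<noteq> b"
  proof
    assume "a = b"
    then have "fps_deriv (g - f) = fps_const (- a) * (g - f)"
      using one by (simp add: algebra_simps flip: fps_const_neg)
    then have "g - f = 0"
      by (rule fps_linear_ODE_unique_zero) (simp add: f01 g01)
    with assms(3) show False by simp
  qed
  \<comment> \<open>In the coefficient of x^2 of \<open>one\<close>, both undifferentiated terms
    equal ab/2 and cancel. Hence the same \<open>c\<close> serves \<open>f\<close> and
    \<open>g\<close>.\<close>
  have f3g3: "6 * g $ 3 = c"
  proof -
    have "(fps_deriv g + fps_const a * g) $ 2 = (fps_deriv f + fps_const b * f) $ 2"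
      by (simp only: one)
    then show ?thesis by (simp add: a_def b_def c_def)
  qed
  define ca where "ca = fps_const a"
  define cb where "cb = fps_const b"
  define cc where "cc = fps_const c"
  have two: "fps_deriv (fps_deriv (g\<^sup>2)) + 3 * ca * fps_deriv (g\<^sup>2) + (3 * ca\<^sup>2 - cc) * g\<^sup>2
           = fps_deriv (fps_deriv (f\<^sup>2)) + 3 * cb * fps_deriv (f\<^sup>2) + (3 * cb\<^sup>2 - cc) * f\<^sup>2"
  proof -
    have sum2: "(\<Sum>k\<le>2. h k) = h 0 + h 1 + h 2" for h :: "nat \<Rightarrow> complex fps"
      by (simp add: numeral_2_eq_2)
    have cf: "(-1) ^ 0 * of_nat (2 choose 0) * q_coeff f 0 (of_nat (Suc 2)) = 1"
        "(-1) ^ 1 * of_nat (2 choose 1) * q_coeff f 1 (of_nat (Suc 2)) = 3 * a"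
        "(-1) ^ 2 * of_nat (2 choose 2) * q_coeff f 2 (of_nat (Suc 2)) = 3 * a\<^sup>2 - c"
      using qf[of "Suc 2"] by (simp_all add: a_def c_def power2_eq_square)
    have cg: "(-1) ^ 0 * of_nat (2 choose 0) * q_coeff g 0 (of_nat (Suc 2)) = 1"
        "(-1) ^ 1 * of_nat (2 choose 1) * q_coeff g 1 (of_nat (Suc 2)) = 3 * b"
        "(-1) ^ 2 * of_nat (2 choose 2) * q_coeff g 2 (of_nat (Suc 2)) = 3 * b\<^sup>2 - c"
      using qg[of "Suc 2"] f3g3 by (simp_all add: b_def power2_eq_square)
    have const: "3 * ca = fps_const (3 * a)" "3 * cb = fps_const (3 * b)"
        "3 * ca\<^sup>2 - cc = fps_const (3 * a\<^sup>2 - c)" "3 * cb\<^sup>2 - cc = fps_const (3 * b\<^sup>2 - c)"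
      by (simp_all add: ca_def cb_def cc_def numeral_fps_const)
    have nth_deriv: "fps_nth_deriv 2 h = fps_deriv (fps_deriv h)" for h :: "complex fps"
      by (simp add: numeral_2_eq_2)
    show ?thesis
      using ODE[of 2] unfolding sum2 cf cg const by (simp add: nth_deriv)
  qed
  define k where "k = fps_const (1 / (b - a))"
  have k: "(cb - ca) * k = 1"
    using ab by (simp add: k_def ca_def cb_def)
  \<comment> \<open>\<open>S\<close> and \<open>C\<close> solve f = S + (a/2) C, g = S + (b/2) C. In
    the final solution with p nonzero they are sinh(px)/p and 2 (cosh(px) - 1)/p^2.\<close>
  define S where "S = k * (cb * f - ca * g)"
  define C where "C = 2 * k * (g - f)"
  \<comment> \<open>Naming the halves keeps the later identities polynomial, without division, for
    \<open>algebra\<close>.\<close>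
  define ha where "ha = fps_const (a / 2)"
  define hb where "hb = fps_const (b / 2)"
  have two_const: "(2 :: complex fps) = fps_const 2" by (simp add: numeral_fps_const)
  have ha: "ca = 2 * ha" and hb: "cb = 2 * hb"
    by (simp_all add: ca_def cb_def ha_def hb_def two_const)
  have const: "fps_deriv ca = 0" "fps_deriv cb = 0" "fps_deriv cc = 0" "fps_deriv ha = 0"
    "fps_deriv hb = 0" "fps_deriv k = 0" "fps_deriv 2 = (0 :: complex fps)"
    "fps_deriv 4 = (0 :: complex fps)"
    by (simp_all add: ca_def cb_def cc_def ha_def hb_def k_def)
  have fSC: "f = S + ha * C" and gSC: "g = S + hb * C"
    using k ha hb unfolding S_def C_def by algebra+
  have C': "fps_deriv C = 2 * S"
    using one unfolding C_def S_def by (simp add: const flip: ca_def cb_def) algebra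
  define S1 where "S1 = fps_deriv S"
  define S2 where "S2 = fps_deriv S1"
  have f': "fps_deriv f = S1 + ca * S" and g': "fps_deriv g = S1 + cb * S"
    by (simp_all add: fSC gSC const C' ha hb flip: S1_def)
  have f'': "fps_deriv (fps_deriv f) = S2 + ca * S1" and g'': "fps_deriv (fps_deriv g) = S2 + cb * S1"
    by (simp_all add: f' g' const flip: S1_def S2_def)
  have sq': "fps_deriv (h\<^sup>2) = 2 * (h * fps_deriv h)" for h :: "complex fps"
    by (simp add: power2_eq_square algebra_simps)
  have sq'': "fps_deriv (fps_deriv (h\<^sup>2)) = 2 * ((fps_deriv h)\<^sup>2 + h * fps_deriv (fps_deriv h))"
    for h :: "complex fps"
    unfolding sq' by (simp add: const power2_eq_square algebra_simps)
  \<comment> \<open>For the hyperbolic functions with c = p^2, E = 0 is the identity cosh^2 - sinh^2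
    = 1 in disguise.\<close>
  define E where "E = 4 * S1 * C - 4 * S\<^sup>2 - cc * C\<^sup>2"
  have E': "fps_deriv E = 4 * (S2 - cc * S) * C"
    unfolding E_def by (simp add: const C' sq' flip: S1_def S2_def) (simp add: algebra_simps)
  \<comment> \<open>Exchanging a and b exchanges \<open>f\<close> and \<open>g\<close>, so the
    difference of the two sides of \<open>two\<close> is antisymmetric and contains the factor b -
    a. The factor 4 clears the halves.\<close>
  have "(cb - ca) * (fps_deriv E + (ca + cb) * E)
      = 4 * (fps_deriv (fps_deriv (g\<^sup>2)) + 3 * ca * fps_deriv (g\<^sup>2) + (3 * ca\<^sup>2 - cc) * g\<^sup>2
        - (fps_deriv (fps_deriv (f\<^sup>2)) + 3 * cb * fps_deriv (f\<^sup>2) + (3 * cb\<^sup>2 - cc) * f\<^sup>2))"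
    unfolding sq''
    unfolding f'' g'' sq'
    unfolding f' g' E'
    unfolding E_def fSC gSC ha hb by algebra
  then have "(cb - ca) * (fps_deriv E + (ca + cb) * E) = 0"
    unfolding two by simp
  then have "fps_deriv E + (ca + cb) * E = 0"
    using k by auto
  moreover have "fps_const (- (a + b)) = - (ca + cb)"
    by (simp add: ca_def cb_def)
  ultimately have E_ode: "fps_deriv E = fps_const (- (a + b)) * E"
    by algebra
  have "C $ 0 = 0" "S $ 0 = 0"
    by (simp_all add: C_def S_def f01 g01)
  then have "E $ 0 = 0"
    by (simp add: E_def power2_eq_square)
  with E_ode have "E = 0" by (rule fps_linear_ODE_unique_zero)
  then have "(S2 - cc * S) * C = 0" using E' by simp
  moreover have "C \<noteq> 0"
    using assms(3) k by (auto simp: C_def)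
  ultimately have S2: "S2 = cc * S" by simp
  define p where "p = csqrt c"
  have p: "p\<^sup>2 = c" by (simp add: p_def)
  \<comment> \<open>Since f' = S' + a S, the equation S'' = c S passes to f'.\<close>
  have f_ode: "fps_deriv (fps_deriv (fps_deriv f)) = fps_const (p\<^sup>2) * fps_deriv f"
    unfolding p f'' f' by (simp add: S2 const algebra_simps flip: S1_def S2_def cc_def)
  have g_ode: "fps_deriv (fps_deriv (fps_deriv g)) = fps_const (p\<^sup>2) * fps_deriv g"
    unfolding p g'' g' by (simp add: S2 const algebra_simps flip: S1_def S2_def cc_def)
  \<comment> \<open>The witness A = a/2 - p/2 matches the coefficient A + p/2 of x^2 with that of
    \<open>f\<close>, which is a/2.\<close>
  have "f = Delta p * (1 + fps_const (a / 2 - p / 2) * Delta (- p))"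
    by (rule fps_third_order_ODE_unique[OF f_ode Delta_product_ODE])
      (simp_all only: Delta_product_low, simp_all add: f01 a_def)
  moreover have "g = Delta p * (1 + fps_const (b / 2 - p / 2) * Delta (- p))"
    by (rule fps_third_order_ODE_unique[OF g_ode Delta_product_ODE])
      (simp_all only: Delta_product_low, simp_all add: g01 b_def)
  ultimately show ?thesis by blast
qed

end
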